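(* Let $G$ be a triangle-free planar graph on $n\geq 5$ vertices. For any two distinct vertices $u, v \in V(G)$, the number of paths of length four (i.e. with five vertices) in $G$ whose endpoints are $u$ and $v$ is at most $\left(\frac{n-1}{2}\right)^2-2$.
   Context: Graphs are finite and simple. A path of length four is a path with four edges and five distinct vertices. *)

theory Defs
  imports "HOL-Analysis.Analysis" "Graph_Theory.Pair_Digraph"
begin

(* A finite simple graph is a pair_graph: a finite, loopfree, symmetric digraph whose arcs are
   pairs of vertices.  The edge xy is the pair of arcs (x,y), (y,x); it is drawn once, so the
   curves c of a drawing are indexed by the unordered edges {x,y}. *)

definition plane_drawing ::
    "'a pair_pre_digraph \<Rightarrow> ('a \<Rightarrow> complex) \<Rightarrow> ('a set \<Rightarrow> real \<Rightarrow> complex) \<Rightarrow> bool" where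
  "plane_drawing G f c \<longleftrightarrow>
     inj_on f (pverts G) \<and>
     (\<forall>(x, y) \<in> parcs G.
        arc (c {x, y}) \<and>
        {pathstart (c {x, y}), pathfinish (c {x, y})} = {f x, f y} \<and>
        path_image (c {x, y}) \<inter> f ` pverts G = {f x, f y}) \<and>
     (\<forall>(x, y) \<in> parcs G. \<forall>(x', y') \<in> parcs G. {x, y} \<noteq> {x', y'} \<longrightarrow>
        path_image (c {x, y}) \<inter> path_image (c {x', y'}) \<subseteq> f ` ({x, y} \<inter> {x', y'}))"

definition planar :: "'a pair_pre_digraph \<Rightarrow> bool" where
  "planar G \<longleftrightarrow> (\<exists>f c. plane_drawing G f c)"

definition triangle_free :: "'a pair_pre_digraph \<Rightarrow> bool" where
  "triangle_free G \<longleftrightarrow>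
     \<not> (\<exists>x y z. (x, y) \<in> parcs G \<and> (y, z) \<in> parcs G \<and> (z, x) \<in> parcs G)"

(* The endpoints are taken in order, so for u \<noteq> v each undirected u-v path is counted once:
   apath u p v has p as the list of arcs traversed from u to v, with no repeated vertex. *)

definition paths_between :: "'a pair_pre_digraph \<Rightarrow> nat \<Rightarrow> 'a \<Rightarrow> 'a \<Rightarrow> ('a \<times> 'a) list set" where
  "paths_between G k u v = {p. pre_digraph.apath (with_proj G) u p v \<and> length p = k}"

end

(* The middle vertex x of a path u a x b v lies outside A \<union> B, where A and B are the neighbourhoods
   of u and v, since G has no triangle.  Hence the number of paths is the sum over the possible x
   of a_x b_x - s_x, where a_x, b_x, s_x count the neighbours of x in A, B and A \<inter> B.  The graph
   between {u, v} \<union> X (X the set of middle vertices) and A \<union> B is bipartite and planar, so it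
   has at most 2N - 4 edges on its N vertices; with d_x = a_x + b_x - s_x this says
   sum (d_x - 2) <= |A \<union> B| - |A \<inter> B|.  The same bound applied to {u, v, x} and its common
   neighbours gives s_x <= 2.  These inequalities imply the claim by convexity.

   The edge bound is proved by counting the components of the complement of the drawing.
   Deleting an edge that lies on a cycle merges two faces, by the Jordan curve theorem, which gives
   Euler's inequality e + 2 <= N + F.  Janiszewski's theorem shows that such an edge touches at most
   two faces and that a forest does not separate the plane; so if there are two faces, then every
   face touches the at least four edges of some cycle, and 4F <= 2e. *)

theory Submission
  imports Defs
begin

section \<open>Edges on cycles\<close>

definition adj_rel :: "'a set set \<Rightarrow> 'a rel" where
  "adj_rel E = {(x, y). {x, y} \<in> E}"

text \<open>An edge lies on a cycle exactly when it is not a bridge. Asking that its ends stay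
  joined after its deletion avoids explicit cycles.\<close>

definition cycle_edge :: "'a set set \<Rightarrow> 'a set \<Rightarrow> bool" where
  "cycle_edge E e \<longleftrightarrow> e \<in> E \<and> (\<forall>x\<in>e. \<forall>y\<in>e. (x, y) \<in> (adj_rel (E - {e}))\<^sup>*)"

definition forest :: "'a set set \<Rightarrow> bool" where
  "forest E \<longleftrightarrow> (\<forall>e\<in>E. \<not> cycle_edge E e)"

definition no_triangle :: "'a set set \<Rightarrow> bool" where
  "no_triangle E \<longleftrightarrow> \<not> (\<exists>x y z. {x, y} \<in> E \<and> {y, z} \<in> E \<and> {z, x} \<in> E)"

lemma adj_rel_mono: "F \<subseteq> E \<Longrightarrow> adj_rel F \<subseteq> adj_rel E"
  by (auto simp: adj_rel_def)

lemma sym_adj_rel: "sym (adj_rel E)"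
  by (auto simp: adj_rel_def sym_def insert_commute)

lemma adj_rel_rtrancl_sym: "(x, y) \<in> (adj_rel E)\<^sup>* \<Longrightarrow> (y, x) \<in> (adj_rel E)\<^sup>*"
  by (meson sym_adj_rel sym_rtrancl symD)

lemma cycle_edge_pair:
  "cycle_edge E {x, y} \<longleftrightarrow> {x, y} \<in> E \<and> (x, y) \<in> (adj_rel (E - {{x, y}}))\<^sup>*"
  unfolding cycle_edge_def by (auto intro: adj_rel_rtrancl_sym)

lemma cycle_edge_mono:
  assumes "F \<subseteq> E" "cycle_edge F e" shows "cycle_edge E e"
proof -
  have "adj_rel (F - {e}) \<subseteq> adj_rel (E - {e})"
    using assms(1) by (intro adj_rel_mono) auto
  then show ?thesis
    using assms unfolding cycle_edge_def by (meson rtrancl_mono subset_eq)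
qed

lemma forest_mono: "F \<subseteq> E \<Longrightarrow> forest E \<Longrightarrow> forest F"
  unfolding forest_def using cycle_edge_mono by blast

text \<open>Cut the walk where it first and last meets \<open>p\<close> or \<open>q\<close>. If
  these are different ends, one crossing of the new edge joins the two pieces; if not, the edge can
  be bypassed.\<close>

lemma rtrancl_adj_rel_insert:
  assumes "(x, y) \<in> (adj_rel (insert {p, q} E))\<^sup>*"
  shows "(x, y) \<in> (adj_rel E)\<^sup>* \<or>
    (x, p) \<in> (adj_rel E)\<^sup>* \<and> (q, y) \<in> (adj_rel E)\<^sup>* \<or>
    (x, q) \<in> (adj_rel E)\<^sup>* \<and> (p, y) \<in> (adj_rel E)\<^sup>*"
  using assms
proof (induction rule: rtrancl_induct)
  case (step y z)
  from step.hyps(2) have "(y, z) \<in> adj_rel E \<or> y = p \<and> z = q \<or> y = q \<and> z = p"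
    by (auto simp: adj_rel_def doubleton_eq_iff)
  then show ?case
    using step.IH by (metis adj_rel_rtrancl_sym rtrancl.rtrancl_into_rtrancl rtrancl.rtrancl_refl rtrancl_trans)
qed auto

text \<open>Every edge of a forest is a bridge. \<open>E1\<close> holds the edges in the component
  of \<open>x\<close> after \<open>e\<close> is deleted, \<open>E2\<close> all the others, including
  those of components far from \<open>e\<close>.\<close>

lemma forest_split:
  assumes "forest E" "e \<in> E" "\<forall>e\<in>E. card e = 2"
  obtains x y E1 E2 where "e = {x, y}" "x \<noteq> y" "E1 \<union> E2 = E - {e}" "E1 \<inter> E2 = {}"
    "\<Union>E1 \<inter> \<Union>E2 = {}" "y \<notin> \<Union>E1" "x \<notin> \<Union>E2"
proof -
  obtain x y where e: "e = {x, y}" and xy: "x \<noteq> y"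
    using assms(2,3) by (metis card_2_iff)
  have "\<not> cycle_edge E e" using assms by (auto simp: forest_def)
  then have nr: "(x, y) \<notin> (adj_rel (E - {e}))\<^sup>*"
    using assms(2) by (auto simp: e cycle_edge_pair)
  define R where "R = (adj_rel (E - {e}))\<^sup>* `` {x}"
  define E1 where "E1 = {e' \<in> E - {e}. e' \<inter> R \<noteq> {}}"
  have all_sub: "e' \<subseteq> R" if e': "e' \<in> E1" for e'
  proof -
    obtain p where p: "p \<in> e'" "(x, p) \<in> (adj_rel (E - {e}))\<^sup>*" "e' \<in> E - {e}"
      using e' unfolding E1_def R_def by blast
    have "q \<in> R" if "q \<in> e'" for q
    proof (cases "q = p")
      case False
      have "e' = {p, q}"
        using assms(3)[rule_format, of e'] p(1,3) that False by (auto simp: card_2_iff)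
      then have "(p, q) \<in> adj_rel (E - {e})" using p(3) by (auto simp: adj_rel_def)
      then show ?thesis using p(2) by (auto simp: R_def)
    qed (use p in \<open>auto simp: R_def\<close>)
    then show ?thesis by blast
  qed
  show thesis
  proof
    show "e = {x, y}" "x \<noteq> y" by (fact e xy)+
    show "E1 \<union> (E - {e} - E1) = E - {e}" "E1 \<inter> (E - {e} - E1) = {}" by (auto simp: E1_def)
    show "\<Union>E1 \<inter> \<Union>(E - {e} - E1) = {}" using all_sub by (auto simp: E1_def)
    show "y \<notin> \<Union>E1" using all_sub nr by (auto simp: R_def)
    show "x \<notin> \<Union>(E - {e} - E1)" by (auto simp: E1_def R_def)
  qed
qed

text \<open>Splitting at \<open>e\<close> divides the vertices into two nonempty parts; the two
  strict inequalities leave room for \<open>e\<close> itself.\<close>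

lemma forest_card:
  assumes "finite V" "V \<noteq> {}" "\<Union>E \<subseteq> V" "forest E" "\<And>e. e \<in> E \<Longrightarrow> card e = 2"
  shows "card E < card V"
  using assms
proof (induction "card E" arbitrary: E V rule: less_induct)
  case less
  have finE: "finite E"
    using less.prems(1,3) by (meson finite_UnionD rev_finite_subset)
  show ?case
  proof (cases "E = {}")
    case False
    then obtain e where e: "e \<in> E" by auto
    have c2: "\<forall>e\<in>E. card e = 2" using less.prems(5) by blast
    obtain x y E1 E2 where *: "e = {x, y}" "x \<noteq> y" "E1 \<union> E2 = E - {e}" "E1 \<inter> E2 = {}"
      "\<Union>E1 \<inter> \<Union>E2 = {}" "y \<notin> \<Union>E1" "x \<notin> \<Union>E2"
      by (rule forest_split[OF less.prems(4) e c2])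
    \<comment> \<open>\<open>x\<close> is inserted because \<open>E1\<close> may be empty;
      \<open>y\<close> keeps the other part nonempty.\<close>
    define V1 where "V1 = insert x (\<Union>E1)"
    have E1: "E1 \<subset> E" and E2: "E2 \<subset> E" using *(3) e by blast+
    have "e \<subseteq> V" "\<Union>E1 \<subseteq> V" using e E1 less.prems(3) by blast+
    then have V1: "V1 \<subseteq> V" "x \<in> V1" "y \<in> V - V1"
      using *(1,2,6) by (auto simp: V1_def)
    have "card E1 < card V1"
    proof (rule less.hyps)
      show "card E1 < card E" using E1 finE by (rule psubset_card_mono[rotated])
      show "finite V1" using V1(1) less.prems(1) by (rule finite_subset)
      show "forest E1" using E1 less.prems(4) forest_mono by blast
      show "card e = 2" if "e \<in> E1" for e using that E1 less.prems(5) by blast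
    qed (auto simp: V1_def)
    moreover have "card E2 < card (V - V1)"
    proof (rule less.hyps)
      show "card E2 < card E" using E2 finE by (rule psubset_card_mono[rotated])
      show "forest E2" using E2 less.prems(4) forest_mono by blast
      show "\<Union>E2 \<subseteq> V - V1"
      proof -
        have "\<Union>E2 \<subseteq> V" using E2 less.prems(3) by blast
        then show ?thesis using *(5,7) by (auto simp: V1_def)
      qed
      show "card e = 2" if "e \<in> E2" for e using that E2 less.prems(5) by blast
    qed (use less.prems(1) V1 in auto)
    moreover have "card E = Suc (card E1 + card E2)"
    proof -
      have "card (E - {e}) = card E1 + card E2"
        using *(4) E1 E2 finE by (metis *(3) card_Un_disjoint finite_subset psubset_imp_subset)
      then show ?thesis using finE e by (metis card_Suc_Diff1)
    qed
    moreover have "card V = card V1 + card (V - V1)"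
      using V1(1) less.prems(1) card_mono[of V V1] by (simp add: card_Diff_subset finite_subset)
    ultimately show ?thesis by linarith
  qed (use less.prems in \<open>simp add: card_gt_0_iff\<close>)
qed

text \<open>Without \<open>e'\<close> the edge \<open>e\<close> would be a bridge, so a walk around
  \<open>e\<close> must use \<open>e'\<close>. The rest of that walk together with \<open>e\<close>
  leads around \<open>e'\<close>.\<close>

lemma cycle_edge_swap:
  assumes "forest (F - {e'})" "cycle_edge F e" "e' \<in> F" "card e = 2" "card e' = 2"
  shows "cycle_edge F e'"
proof (cases "e = e'")
  case False
  obtain x y where e: "e = {x, y}" using assms(4) by (auto simp: card_2_iff)
  obtain p q where e': "e' = {p, q}" using assms(5) by (auto simp: card_2_iff)
  let ?G = "F - {e'} - {e}"
  have "\<not> cycle_edge (F - {e'}) e" "e \<in> F"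
    using assms False by (auto simp: forest_def cycle_edge_def)
  then have n: "(x, y) \<notin> (adj_rel ?G)\<^sup>*"
    using False by (auto simp: e cycle_edge_pair)
  have "(x, y) \<in> (adj_rel (F - {e}))\<^sup>*"
    using assms(2) by (auto simp: e cycle_edge_pair)
  moreover have "F - {e} = insert {p, q} ?G"
    using assms(3) False by (auto simp: e')
  ultimately have "(x, p) \<in> (adj_rel ?G)\<^sup>* \<and> (q, y) \<in> (adj_rel ?G)\<^sup>* \<or>
    (x, q) \<in> (adj_rel ?G)\<^sup>* \<and> (p, y) \<in> (adj_rel ?G)\<^sup>*"
    using rtrancl_adj_rel_insert[of x y p q ?G] n by auto
  moreover have "(adj_rel ?G)\<^sup>* \<subseteq> (adj_rel (F - {e'}))\<^sup>*"
    by (intro rtrancl_mono adj_rel_mono) auto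
  moreover have "(x, y) \<in> adj_rel (F - {e'})"
    using \<open>e \<in> F\<close> False by (auto simp: adj_rel_def e)
  ultimately have "(p, q) \<in> (adj_rel (F - {e'}))\<^sup>*"
    by (meson adj_rel_rtrancl_sym r_into_rtrancl rtrancl_trans subsetD)
  then show ?thesis using assms(3) by (auto simp: e' cycle_edge_pair)
qed (use assms in simp)

text \<open>In a minimal subset \<open>F\<close> that is not a forest every edge lies on a cycle, by
  the exchange above. Hence a trail in \<open>F\<close> can always be continued without turning
  back.\<close>

lemma not_forest_4_cycle_edges:
  assumes fin: "finite E" and c2: "\<And>e. e \<in> E \<Longrightarrow> card e = 2"
    and tf: "no_triangle E" and nf: "\<not> forest E"
  shows "4 \<le> card {e \<in> E. cycle_edge E e}"
proof -
  have "finite {F. F \<subseteq> E \<and> \<not> forest F}" "{F. F \<subseteq> E \<and> \<not> forest F} \<noteq> {}"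
    using fin nf by auto
  from finite_has_minimal[OF this] obtain F where F: "F \<subseteq> E" "\<not> forest F"
    and min: "\<forall>F'. F' \<subseteq> E \<and> \<not> forest F' \<longrightarrow> F' \<subseteq> F \<longrightarrow> F = F'"
    by auto
  obtain e0 where e0: "e0 \<in> F" "cycle_edge F e0"
    using F(2) by (auto simp: forest_def)
  have cyc: "cycle_edge F e" if "e \<in> F" for e
  proof (rule cycle_edge_swap[where e = e0])
    show "forest (F - {e})"
      using min[rule_format, of "F - {e}"] F(1) that by blast
  qed (use that e0 F(1) c2 in auto)
  have next_edge: "\<exists>z. {x, z} \<in> F \<and> z \<noteq> y \<and> z \<noteq> x" if "{x, y} \<in> F" for x y
  proof -
    have "card {x, y} = 2" using c2 F(1) that by blast
    then have "x \<noteq> y" by auto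
    moreover have "(x, y) \<in> (adj_rel (F - {{x, y}}))\<^sup>*"
      using cyc[OF that] by (auto simp: cycle_edge_pair)
    ultimately obtain z where z: "(x, z) \<in> adj_rel (F - {{x, y}})"
      by (meson converse_rtranclE)
    then have "{x, z} \<in> F" "z \<noteq> y" by (auto simp: adj_rel_def)
    moreover have "card {x, z} = 2" using c2 F(1) \<open>{x, z} \<in> F\<close> by blast
    then have "z \<noteq> x" by auto
    ultimately show ?thesis by blast
  qed
  obtain x y where xy: "{x, y} \<in> F" "x \<noteq> y"
    using e0(1) c2[of e0] F(1) by (auto simp: card_2_iff subset_iff)
  obtain z where z: "{y, z} \<in> F" "z \<noteq> x" "z \<noteq> y"
    using next_edge[of y x] xy by (auto simp: insert_commute)
  obtain w where w: "{z, w} \<in> F" "w \<noteq> y" "w \<noteq> z"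
    using next_edge[of z y] z by (auto simp: insert_commute)
  obtain t where t: "{w, t} \<in> F" "t \<noteq> z" "t \<noteq> w"
    using next_edge[of w z] w by (auto simp: insert_commute)
  \<comment> \<open>This excludes a triangle. \<open>t\<close> may equal \<open>x\<close>, closing a
    4-cycle; the four edges are distinct in any case.\<close>
  have "w \<noteq> x" using tf F(1) xy z w unfolding no_triangle_def by blast
  have "card {{x, y}, {y, z}, {z, w}, {w, t}} = 4"
    using xy z w t \<open>w \<noteq> x\<close> by (auto simp: card_insert_if doubleton_eq_iff)
  moreover have "{{x, y}, {y, z}, {z, w}, {w, t}} \<subseteq> {e \<in> E. cycle_edge E e}"
    using xy(1) z(1) w(1) t(1) F(1) cyc cycle_edge_mono[OF F(1)] by blast
  moreover have "finite {e \<in> E. cycle_edge E e}" using fin by simp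
  ultimately show ?thesis by (metis card_mono)
qed

section \<open>Faces of a plane drawing\<close>

definition drawn :: "('a set \<Rightarrow> real \<Rightarrow> complex) \<Rightarrow> 'a set set \<Rightarrow> complex set" where
  "drawn \<gamma> E = (\<Union>e\<in>E. path_image (\<gamma> e))"

lemma drawn_Un: "drawn \<gamma> (E \<union> F) = drawn \<gamma> E \<union> drawn \<gamma> F"
  by (auto simp: drawn_def)

lemma drawn_mono: "E \<subseteq> F \<Longrightarrow> drawn \<gamma> E \<subseteq> drawn \<gamma> F"
  by (auto simp: drawn_def)

lemma drawn_single [simp]: "drawn \<gamma> {e} = path_image (\<gamma> e)"
  by (simp add: drawn_def)

text \<open>Only the edges enter, so the structure passes to every subset of them. Ends are compared
  as sets, which leaves the direction of each arc open.\<close>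

locale plane_arcs =
  fixes E :: "'a set set" and f :: "'a \<Rightarrow> complex" and \<gamma> :: "'a set \<Rightarrow> real \<Rightarrow> complex"
  assumes finite_edges: "finite E"
    and card_edge: "e \<in> E \<Longrightarrow> card e = 2"
    and inj_vertices: "inj_on f (\<Union>E)"
    and arc_edge: "e \<in> E \<Longrightarrow> arc (\<gamma> e)"
    and ends_edge: "e \<in> E \<Longrightarrow> {pathstart (\<gamma> e), pathfinish (\<gamma> e)} = f ` e"
    and edges_meet: "e \<in> E \<Longrightarrow> e' \<in> E \<Longrightarrow> e \<noteq> e' \<Longrightarrow>
      path_image (\<gamma> e) \<inter> path_image (\<gamma> e') \<subseteq> f ` (e \<inter> e')"
begin

definition faces :: "complex set set" where
  "faces = components (- drawn \<gamma> E)"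

text \<open>The ends of the arc are removed because a face can reach a vertex without bordering
  every edge there.\<close>

definition touches :: "'a set \<Rightarrow> complex set \<Rightarrow> bool" where
  "touches e \<Phi> \<longleftrightarrow> (path_image (\<gamma> e) - f ` e) \<inter> closure \<Phi> \<noteq> {}"

lemma plane_arcs_subset: "F \<subseteq> E \<Longrightarrow> plane_arcs F f \<gamma>"
proof unfold_locales
  assume F: "F \<subseteq> E"
  show "finite F" using F finite_edges by (rule finite_subset)
  show "inj_on f (\<Union>F)" using F inj_vertices by (meson Union_mono inj_on_subset)
qed (use card_edge arc_edge ends_edge edges_meet in blast)+

lemma finite_vertices: "finite (\<Union>E)"
  using finite_edges card_edge by (metis card.infinite finite_Union zero_neq_numeral)

lemma compact_drawn: "F \<subseteq> E \<Longrightarrow> compact (drawn \<gamma> F)"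
  unfolding drawn_def using finite_edges arc_edge
  by (intro compact_UN) (auto intro: finite_subset compact_arc_image)

lemma open_compl_drawn: "F \<subseteq> E \<Longrightarrow> open (- drawn \<gamma> F)"
  using compact_drawn compact_imp_closed by blast

lemma ends_subset: "e \<in> E \<Longrightarrow> f ` e \<subseteq> path_image (\<gamma> e)"
  using ends_edge[of e] by (metis empty_subsetI insert_subset pathfinish_in_path_image pathstart_in_path_image)

lemma drawn_Int:
  assumes "F \<subseteq> E" "F' \<subseteq> E" "F \<inter> F' = {}"
  shows "drawn \<gamma> F \<inter> drawn \<gamma> F' \<subseteq> f ` (\<Union>F \<inter> \<Union>F')"
proof
  fix z assume "z \<in> drawn \<gamma> F \<inter> drawn \<gamma> F'"
  then obtain e e' where *: "e \<in> F" "e' \<in> F'" "z \<in> path_image (\<gamma> e) \<inter> path_image (\<gamma> e')"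
    by (auto simp: drawn_def)
  then have "z \<in> f ` (e \<inter> e')"
    using assms edges_meet[of e e'] by blast
  then show "z \<in> f ` (\<Union>F \<inter> \<Union>F')" using * by blast
qed

lemma edge_Int_rest: "e \<in> E \<Longrightarrow> path_image (\<gamma> e) \<inter> drawn \<gamma> (E - {e}) \<subseteq> f ` e"
  using drawn_Int[of "{e}" "E - {e}"] by auto

lemma drawn_insert_edge: "e \<in> E \<Longrightarrow> drawn \<gamma> E = drawn \<gamma> (E - {e}) \<union> path_image (\<gamma> e)"
  by (auto simp: drawn_def)

end

text \<open>By Janiszewski's theorem, two compact sets that do not separate the plane and meet in a
  connected set have a union that does not separate it either. The parts of a split forest share at
  most one point.\<close>

lemma forest_connected_complement:
  assumes "plane_arcs E f \<gamma>" "forest E"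
  shows "connected (- drawn \<gamma> E)"
  using assms
proof (induction "card E" arbitrary: E rule: less_induct)
  case less
  interpret plane_arcs E f \<gamma> by fact
  have IH: "connected (- drawn \<gamma> F)" if "F \<subset> E" for F
    using that less.hyps[of F] plane_arcs_subset[of F] forest_mono[of F E] less.prems(2)
      finite_edges psubset_card_mono[of E F] by auto
  show ?case
  proof (cases "E = {}")
    case False
    then obtain e where e: "e \<in> E" by auto
    have c2: "\<forall>e\<in>E. card e = 2" using card_edge by blast
    obtain x y E1 E2 where *: "e = {x, y}" "x \<noteq> y" "E1 \<union> E2 = E - {e}" "E1 \<inter> E2 = {}"
      "\<Union>E1 \<inter> \<Union>E2 = {}" "y \<notin> \<Union>E1" "x \<notin> \<Union>E2"
      by (rule forest_split[OF less.prems(2) e c2])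
    show ?thesis
    \<comment> \<open>If \<open>E1\<close> is empty, \<open>insert e E2\<close> is all of
      \<open>E\<close> and induction does not apply to it; then the single arc of \<open>e\<close>
      is split off instead.\<close>
    proof (cases "E1 = {}")
      case True
      then have E2: "E2 = E - {e}" using *(3) by auto
      have "drawn \<gamma> E2 \<inter> path_image (\<gamma> e) \<subseteq> {f y}"
        using drawn_Int[of E2 "{e}"] e *(1,7) by (auto simp: E2)
      then have "connected (drawn \<gamma> E2 \<inter> path_image (\<gamma> e))"
        by (metis connected_empty connected_sing subset_singletonD)
      then have "connected (- (drawn \<gamma> E2 \<union> path_image (\<gamma> e)))"
        using e by (intro Janiszewski_connected compact_drawn IH)
          (auto simp: E2 arc_edge closed_arc_image connected_arc_complement)
      then show ?thesis using drawn_insert_edge[OF e] by (simp add: E2)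
    next
      case False
      have sub: "E1 \<subset> E" "insert e E2 \<subset> E" "E1 \<inter> insert e E2 = {}"
        using *(3,4) e False by auto
      have "drawn \<gamma> E1 \<inter> drawn \<gamma> (insert e E2) \<subseteq> {f x}"
      proof -
        have "\<Union>E1 \<inter> \<Union>(insert e E2) \<subseteq> {x}" using *(1,5,6) by auto
        moreover have "drawn \<gamma> E1 \<inter> drawn \<gamma> (insert e E2) \<subseteq> f ` (\<Union>E1 \<inter> \<Union>(insert e E2))"
          using sub by (intro drawn_Int) auto
        ultimately show ?thesis by (metis image_empty image_insert image_mono order_trans)
      qed
      then have "connected (drawn \<gamma> E1 \<inter> drawn \<gamma> (insert e E2))"
        by (metis connected_empty connected_sing subset_singletonD)
      then have "connected (- (drawn \<gamma> E1 \<union> drawn \<gamma> (insert e E2)))"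
        using sub by (intro Janiszewski_connected IH compact_drawn compact_imp_closed) auto
      moreover have "E1 \<union> insert e E2 = E" using *(3) e by auto
      ultimately show ?thesis by (metis drawn_Un)
    qed
  qed (simp add: drawn_def connected_UNIV)
qed

section \<open>Faces at an edge that lies on a cycle\<close>

context plane_arcs
begin

text \<open>The arcs of the edges trace the walk. For \<open>x = y\<close> the walk may be empty,
  and \<open>f x\<close> need not lie on the drawing.\<close>

lemma rtrancl_path_component:
  assumes "F \<subseteq> E" "(x, y) \<in> (adj_rel F)\<^sup>*" "x \<noteq> y"
  shows "path_component (drawn \<gamma> F) (f x) (f y)"
proof -
  have edge: "path_component (drawn \<gamma> F) (f p) (f q)" if "(p, q) \<in> adj_rel F" for p q
  proof -
    have pq: "{p, q} \<in> F" using that by (simp add: adj_rel_def)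
    have "path_component (path_image (\<gamma> {p, q})) (f p) (f q)"
      using ends_subset[of "{p, q}"] arc_edge[of "{p, q}"] pq assms(1)
      by (intro path_connected_component[THEN iffD1, rule_format, OF path_connected_path_image])
        (auto intro: arc_imp_path)
    then show ?thesis
      using pq by (auto simp: drawn_def intro: path_component_of_subset[rotated])
  qed
  have "x = y \<or> path_component (drawn \<gamma> F) (f x) (f y)"
    using assms(2)
    by (induction rule: rtrancl_induct) (use edge path_component_trans in blast)+
  then show ?thesis using assms(3) by auto
qed

text \<open>The ends of \<open>e\<close> are joined by a path along the other edges. An arc
  \<open>g\<close> inside it meets the arc of \<open>e\<close> only at the ends, so both form a
  Jordan curve.\<close>

lemma cycle_edge_curve:
  assumes "cycle_edge E e"
  obtains g z where "simple_path z" "pathfinish z = pathstart z"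
    "path_image z = path_image (\<gamma> e) \<union> path_image g" "path g" "f ` e \<subseteq> path_image g"
    "path_image g \<subseteq> drawn \<gamma> (E - {e})"
proof -
  have e: "e \<in> E" using assms by (simp add: cycle_edge_def)
  define a b where "a = pathstart (\<gamma> e)" and "b = pathfinish (\<gamma> e)"
  have fe: "f ` e = {a, b}" using ends_edge[OF e] by (simp add: a_def b_def)
  have ab: "a \<noteq> b" using arc_edge[OF e] unfolding a_def b_def by (metis arc_distinct_ends)
  obtain x y where xy: "x \<in> e" "y \<in> e" "f x = b" "f y = a" using fe by (metis imageE insertI1 insertI2)
  have "path_component (drawn \<gamma> (E - {e})) b a"
    using rtrancl_path_component[of "E - {e}" x y] assms xy ab by (auto simp: cycle_edge_def)
  then obtain p where p: "path p" "path_image p \<subseteq> drawn \<gamma> (E - {e})" "pathstart p = b" "pathfinish p = a"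
    by (auto simp: path_component_def)
  obtain g where g: "arc g" "path_image g \<subseteq> path_image p" "pathstart g = b" "pathfinish g = a"
    using path_contains_arc[OF p(1,3,4)] ab by metis
  have "path_image (\<gamma> e) \<inter> path_image g \<subseteq> {a, b}"
    using edge_Int_rest[OF e] g(2) p(2) fe by blast
  then have "simple_path (\<gamma> e +++ g)"
    using g arc_edge[OF e] by (intro simple_path_join_loop) (auto simp: a_def b_def)
  moreover have "path_image (\<gamma> e +++ g) = path_image (\<gamma> e) \<union> path_image g"
    using g by (intro path_image_join) (simp add: b_def)
  moreover have "pathfinish (\<gamma> e +++ g) = pathstart (\<gamma> e +++ g)"
    using g by (simp add: a_def)
  moreover have "f ` e \<subseteq> path_image g" using fe g by auto
  ultimately show thesis using that g p arc_imp_path by (metis order_trans)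
qed

text \<open>The Jordan curve \<open>Z\<close> through \<open>e\<close> has two sides, and each
  contains at most one face touching \<open>e\<close>.\<close>

lemma faces_touching_cycle_edge:
  assumes "cycle_edge E e"
  shows "finite {\<Phi> \<in> faces. touches e \<Phi>}" "card {\<Phi> \<in> faces. touches e \<Phi>} \<le> 2"
proof -
  have e: "e \<in> E" using assms by (simp add: cycle_edge_def)
  obtain g z where z: "simple_path z" "pathfinish z = pathstart z"
    "path_image z = path_image (\<gamma> e) \<union> path_image g" "path g" "f ` e \<subseteq> path_image g"
    "path_image g \<subseteq> drawn \<gamma> (E - {e})"
    using cycle_edge_curve[OF assms] .
  define Z where "Z = path_image z"
  have J: "inside Z \<inter> outside Z = {}" "inside Z \<union> outside Z = - Z" "open (inside Z)" "open (outside Z)"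
    "connected (inside Z)" "connected (outside Z)" "frontier (inside Z) = Z" "frontier (outside Z) = Z"
    using Jordan_inside_outside[OF z(1,2)] by (simp_all add: Z_def)
  let ?D = "drawn \<gamma> (E - {e})" and ?O = "path_image (\<gamma> e) - f ` e"
  have DZ: "drawn \<gamma> E = ?D \<union> Z"
    using drawn_insert_edge[OF e] z(3,6) by (auto simp: Z_def)
  \<comment> \<open>The arc of \<open>e\<close> meets the other edges only at its ends, which lie on
    \<open>g\<close>. This yields the connected intersection for Janiszewski's theorem.\<close>
  have "?D \<inter> Z = path_image g"
    using edge_Int_rest[OF e] z(3,5,6) by (auto simp: Z_def)
  then have conn: "connected (?D \<inter> Z)" using z(4) connected_path_image by simp
  have conn_O: "connected ?O"
    using connected_simple_path_endless[OF arc_imp_simple_path[OF arc_edge[OF e]]] ends_edge[OF e] by simp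
  have O_D: "?O \<inter> ?D = {}" using edge_Int_rest[OF e] by auto
  have closed_Z: "closed Z" using z(1) by (simp add: Z_def closed_simple_path_image)
  have faceE: "connected \<Phi>" "\<Phi> \<subseteq> - ?D" "\<Phi> \<subseteq> - Z" "\<Phi> \<noteq> {}" if "\<Phi> \<in> faces" for \<Phi>
    using that in_components_connected[of \<Phi>] in_components_subset[of \<Phi>] in_components_nonempty[of \<Phi>]
    by (auto simp: faces_def DZ)
  \<comment> \<open>Janiszewski: faces touching the edge are joined across it off the other edges, and these
    meet the cycle \<open>Z\<close> in a connected set, so two such faces on one side of \<open>Z\<close> coincide.\<close>
  have same: "\<Phi>1 = \<Phi>2"
    if \<Phi>: "\<Phi>1 \<in> faces" "touches e \<Phi>1" "\<Phi>2 \<in> faces" "touches e \<Phi>2"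
      and U: "connected U" "U \<subseteq> - Z" "\<Phi>1 \<subseteq> U" "\<Phi>2 \<subseteq> U" for \<Phi>1 \<Phi>2 U
  proof -
    obtain p q where pq: "p \<in> \<Phi>1" "q \<in> \<Phi>2" using faceE(4) \<Phi>(1,3) by blast
    \<comment> \<open>The open arc \<open>?O\<close> is connected and contains a limit point
      \<open>m\<close> of the face.\<close>
    have join: "connected (\<Phi> \<union> ?O)" if \<Phi>: "\<Phi> \<in> faces" "touches e \<Phi>" for \<Phi>
    proof -
      obtain m where m: "m \<in> ?O" "m \<in> closure \<Phi>" using \<Phi>(2) by (auto simp: touches_def)
      have "connected (insert m \<Phi>)"
        by (rule connected_intermediate_closure[OF faceE(1)[OF \<Phi>(1)] subset_insertI])
          (use m(2) closure_subset in blast)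
      then have "connected (insert m \<Phi> \<union> ?O)"
        using conn_O m(1) by (intro connected_Un) auto
      moreover have "insert m \<Phi> \<union> ?O = \<Phi> \<union> ?O" using m(1) by auto
      ultimately show ?thesis by simp
    qed
    have "?O \<noteq> {}" using \<Phi>(2) by (auto simp: touches_def)
    then have "connected ((\<Phi>1 \<union> ?O) \<union> (\<Phi>2 \<union> ?O))"
      using \<Phi> by (intro connected_Un join) auto
    moreover have "(\<Phi>1 \<union> ?O) \<union> (\<Phi>2 \<union> ?O) \<subseteq> - ?D"
      using faceE(2) \<Phi>(1,3) O_D by blast
    ultimately have "connected_component (- ?D) p q"
      using pq unfolding connected_component_def by blast
    moreover have "connected_component (- Z) p q"
      using U pq unfolding connected_component_def by blast
    ultimately have "connected_component (- drawn \<gamma> E) p q"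
      unfolding DZ using conn closed_Z by (intro Janiszewski compact_drawn) auto
    then obtain T where "connected T" "T \<subseteq> - drawn \<gamma> E" "p \<in> T" "q \<in> T"
      by (auto simp: connected_component_def)
    then show ?thesis
      using \<Phi>(1,3) pq joinable_components_eq[of T "- drawn \<gamma> E" \<Phi>1 \<Phi>2] unfolding faces_def by blast
  qed
  have side: "\<Phi> \<subseteq> inside Z \<or> \<Phi> \<subseteq> outside Z" if "\<Phi> \<in> faces" for \<Phi>
  proof -
    have "\<Phi> \<subseteq> inside Z \<union> outside Z" using faceE(3)[OF that] J(2) by simp
    moreover from this have "inside Z \<inter> \<Phi> = {} \<or> outside Z \<inter> \<Phi> = {}"
      using connectedD[OF faceE(1)[OF that] J(3,4)] J(1) by auto
    ultimately show ?thesis by blast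
  qed
  \<comment> \<open>The side of \<open>Z\<close> is recorded as a Boolean, so the bound 2 is the
    size of that type.\<close>
  have inj: "inj_on (\<lambda>\<Phi>. \<Phi> \<subseteq> inside Z) {\<Phi> \<in> faces. touches e \<Phi>}"
  proof (rule inj_onI, clarify)
    fix \<Phi>1 \<Phi>2
    assume \<Phi>: "\<Phi>1 \<in> faces" "touches e \<Phi>1" "\<Phi>2 \<in> faces" "touches e \<Phi>2"
      and eq: "(\<Phi>1 \<subseteq> inside Z) = (\<Phi>2 \<subseteq> inside Z)"
    have "inside Z \<subseteq> - Z" "outside Z \<subseteq> - Z" using J(2) by blast+
    then show "\<Phi>1 = \<Phi>2"
      using same[OF \<Phi> J(5)] same[OF \<Phi> J(6)] side[OF \<Phi>(1)] side[OF \<Phi>(3)] eq by blast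
  qed
  show "finite {\<Phi> \<in> faces. touches e \<Phi>}"
    by (rule finite_imageD[OF _ inj]) simp
  show "card {\<Phi> \<in> faces. touches e \<Phi>} \<le> 2"
    using card_inj_on_le[OF inj, of UNIV] by simp
qed

text \<open>Send each face to the component containing it after the deletion. This map
  \<open>k\<close> is onto, and not injective because the faces on the two sides of \<open>e\<close>
  merge.\<close>

lemma card_faces_delete_cycle_edge:
  assumes "cycle_edge E e" "finite faces"
  shows "finite (components (- drawn \<gamma> (E - {e})))"
    "card (components (- drawn \<gamma> (E - {e}))) < card faces"
proof -
  have e: "e \<in> E" using assms by (simp add: cycle_edge_def)
  obtain g z where z: "simple_path z" "pathfinish z = pathstart z"
    "path_image z = path_image (\<gamma> e) \<union> path_image g" "path g" "f ` e \<subseteq> path_image g"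
    "path_image g \<subseteq> drawn \<gamma> (E - {e})"
    using cycle_edge_curve[OF assms(1)] .
  define Z where "Z = path_image z"
  have J: "inside Z \<inter> outside Z = {}" "inside Z \<union> outside Z = - Z" "open (inside Z)" "open (outside Z)"
    "connected (inside Z)" "connected (outside Z)" "frontier (inside Z) = Z" "frontier (outside Z) = Z"
    using Jordan_inside_outside[OF z(1,2)] by (simp_all add: Z_def)
  let ?D = "drawn \<gamma> (E - {e})"
  have Z_sub: "Z \<subseteq> drawn \<gamma> E" and e_Z: "path_image (\<gamma> e) \<subseteq> Z"
    using drawn_insert_edge[OF e] z(3,6) by (auto simp: Z_def)
  have openD: "open (- ?D)" by (rule open_compl_drawn) auto
  \<comment> \<open>By the Jordan curve theorem every point of \<open>Z\<close> is a boundary point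
    of both sides.\<close>
  have meets: "U \<inter> inside Z \<noteq> {}" "U \<inter> outside Z \<noteq> {}"
    if "open U" "m \<in> U" "m \<in> path_image (\<gamma> e)" for U m
  proof -
    have "m \<in> closure (inside Z)" "m \<in> closure (outside Z)"
      using J(7,8) e_Z that(3) unfolding frontier_def by blast+
    then show "U \<inter> inside Z \<noteq> {}" "U \<inter> outside Z \<noteq> {}"
      using that(1,2) open_Int_closure_eq_empty[of U] by blast+
  qed
  \<comment> \<open>Any point of the face serves as representative, as \<open>k_eq\<close>
    shows.\<close>
  define k where "k \<Phi> = connected_component_set (- ?D) (SOME p. p \<in> \<Phi>)" for \<Phi>
  have k_eq: "k \<Phi> = connected_component_set (- ?D) p" if "\<Phi> \<in> faces" "p \<in> \<Phi>" for \<Phi> p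
  proof -
    have "(SOME p. p \<in> \<Phi>) \<in> \<Phi>" using that(2) by (rule someI)
    moreover have "connected \<Phi>" "\<Phi> \<subseteq> - ?D"
      using that(1) in_components_connected in_components_subset[of \<Phi>] drawn_insert_edge[OF e]
      unfolding faces_def by blast+
    ultimately have "connected_component (- ?D) (SOME p. p \<in> \<Phi>) p"
      using that(2) unfolding connected_component_def by blast
    then show ?thesis unfolding k_def by (metis connected_component_eq mem_Collect_eq)
  qed
  have face_of: "connected_component_set (- drawn \<gamma> E) p \<in> faces"
    "p \<in> connected_component_set (- drawn \<gamma> E) p" if "p \<notin> drawn \<gamma> E" for p
    using that by (auto simp: faces_def components_def)
  have k_surj: "components (- ?D) = k ` faces"
  proof (intro equalityI subsetI)
    fix U assume U: "U \<in> components (- ?D)"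
    obtain x where x: "x \<in> U" using U in_components_nonempty by fastforce
    have openU: "open U" using U openD open_components by blast
    have UD: "U \<subseteq> - ?D" using U by (rule in_components_subset)
    \<comment> \<open>An open set is not contained in the arc: near a point of the arc it meets
      \<open>inside Z\<close>.\<close>
    have "\<exists>p\<in>U. p \<notin> path_image (\<gamma> e)"
    proof (cases "x \<in> path_image (\<gamma> e)")
      case True
      then obtain p where "p \<in> U" "p \<in> inside Z" using meets(1)[OF openU x] by blast
      moreover have "inside Z \<inter> path_image (\<gamma> e) = {}" using J(2) e_Z by blast
      ultimately show ?thesis by blast
    qed (use x in blast)
    then obtain p where p: "p \<in> U" "p \<notin> drawn \<gamma> E" using UD drawn_insert_edge[OF e] by blast
    have "connected_component_set (- ?D) p = U"
      using U p(1) by (metis components_iff connected_component_eq)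
    then show "U \<in> k ` faces"
      using k_eq[OF face_of[OF p(2)]] face_of(1)[OF p(2)] by blast
  next
    fix U assume "U \<in> k ` faces"
    then obtain \<Phi> where \<Phi>: "\<Phi> \<in> faces" "U = k \<Phi>" by auto
    obtain p where p: "p \<in> \<Phi>" using \<Phi>(1) in_components_nonempty unfolding faces_def by fastforce
    have "p \<in> - drawn \<gamma> E" using \<Phi>(1) p in_components_subset unfolding faces_def by blast
    then have "p \<in> - ?D" using drawn_insert_edge[OF e] by blast
    then show "U \<in> components (- ?D)" using k_eq[OF \<Phi>(1) p] \<Phi>(2) by (auto simp: components_def)
  qed
  show fin: "finite (components (- ?D))" using k_surj assms(2) by simp
  \<comment> \<open>Near an interior point of the edge there are points on both sides of \<open>Z\<close>.\<close>
  have "\<not> inj_on k faces"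
  proof
    assume inj: "inj_on k faces"
    have "path_image (\<gamma> e) - f ` e \<noteq> {}"
      using nonempty_simple_path_endless[OF arc_imp_simple_path[OF arc_edge[OF e]]] ends_edge[OF e] by simp
    then obtain m where m: "m \<in> path_image (\<gamma> e)" "m \<notin> f ` e" by blast
    then have "m \<in> - ?D" using edge_Int_rest[OF e] by blast
    then obtain r where r: "r > 0" "ball m r \<subseteq> - ?D"
      using openD open_contains_ball by blast
    obtain p where p: "p \<in> ball m r" "p \<in> inside Z"
      using meets(1)[of "ball m r" m] m(1) r(1) by auto
    obtain q where q: "q \<in> ball m r" "q \<in> outside Z"
      using meets(2)[of "ball m r" m] m(1) r(1) by auto
    have pq: "p \<notin> drawn \<gamma> E" "q \<notin> drawn \<gamma> E"
    proof -
      have "p \<in> - Z" "q \<in> - Z" using p(2) q(2) J(2) by blast+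
      then show "p \<notin> drawn \<gamma> E" "q \<notin> drawn \<gamma> E"
        using p(1) q(1) r(2) e_Z drawn_insert_edge[OF e] by blast+
    qed
    have "connected_component (- ?D) p q"
      using p q r(2) unfolding connected_component_def by (meson connected_ball)
    then have "k (connected_component_set (- drawn \<gamma> E) p) = k (connected_component_set (- drawn \<gamma> E) q)"
      using k_eq[OF face_of[OF pq(1)]] k_eq[OF face_of[OF pq(2)]] connected_component_eq_eq by (metis connected_component_eq CollectI)
    then have "connected_component_set (- drawn \<gamma> E) p = connected_component_set (- drawn \<gamma> E) q"
      using inj face_of(1)[OF pq(1)] face_of(1)[OF pq(2)] by (auto dest: inj_onD)
    then have "connected_component (- drawn \<gamma> E) p q"
      using face_of(2)[OF pq(2)] by auto
    then have "connected_component (- Z) p q"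
      using Z_sub by (meson Compl_anti_mono connected_component_of_subset)
    then obtain T where T: "connected T" "T \<subseteq> - Z" "p \<in> T" "q \<in> T"
      by (auto simp: connected_component_def)
    then show False
      using connectedD[OF T(1) J(3,4)] J(1,2) p(2) q(2) by blast
  qed
  then show "card (components (- ?D)) < card faces"
    unfolding k_surj using assms(2) card_image_le eq_card_imp_inj_on by (metis le_neq_implies_less)
qed

section \<open>The edges around a face\<close>

lemma open_face: "\<Phi> \<in> faces \<Longrightarrow> open \<Phi>"
  unfolding faces_def using open_components open_compl_drawn by blast

lemma faces_disjoint: "\<Phi> \<in> faces \<Longrightarrow> \<Phi>' \<in> faces \<Longrightarrow> \<Phi> \<noteq> \<Phi>' \<Longrightarrow> \<Phi> \<inter> \<Phi>' = {}"
  unfolding faces_def using components_nonoverlap by blast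

text \<open>A point off the drawing lies in an open face, which is \<Phi> itself or disjoint from
  \<Phi>.\<close>

lemma frontier_face:
  assumes "\<Phi> \<in> faces" shows "frontier \<Phi> \<subseteq> drawn \<gamma> E"
proof
  fix z assume z: "z \<in> frontier \<Phi>"
  show "z \<in> drawn \<gamma> E"
  proof (rule ccontr)
    assume "z \<notin> drawn \<gamma> E"
    then obtain \<Psi> where \<Psi>: "\<Psi> \<in> faces" "z \<in> \<Psi>"
      using Union_components[of "- drawn \<gamma> E"] unfolding faces_def by (metis ComplI UnionE)
    have "z \<in> closure \<Phi>" "z \<notin> \<Phi>"
      using z open_face[OF assms] by (auto simp: frontier_def interior_open)
    then have "\<Psi> \<inter> \<Phi> \<noteq> {}"
      using open_face[OF \<Psi>(1)] \<Psi>(2) open_Int_closure_eq_empty by blast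
    then show False using faces_disjoint[OF \<Psi>(1) assms] \<Psi>(2) \<open>z \<notin> \<Phi>\<close> by blast
  qed
qed

text \<open>If the edges touching \<Phi> formed a forest, their complement would be connected, and
  no other edge could bound \<Phi> inside it; so \<Phi> would swallow \<Phi>'.\<close>

lemma face_touches_4_cycle_edges:
  assumes "no_triangle E" and \<Phi>: "\<Phi> \<in> faces" "\<Phi>' \<in> faces" "\<Phi> \<noteq> \<Phi>'"
  shows "4 \<le> card {e \<in> E. cycle_edge E e \<and> touches e \<Phi>}"
proof -
  define F where "F = {e \<in> E. touches e \<Phi>}"
  have F: "F \<subseteq> E" by (auto simp: F_def)
  interpret F: plane_arcs F f \<gamma> using F by (rule plane_arcs_subset)
  have "\<not> forest F"
  proof
    assume "forest F"
    then have "connected (- drawn \<gamma> F)"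
      using forest_connected_complement[OF F.plane_arcs_axioms] by simp
    \<comment> \<open>\<open>touches\<close> ignores the ends of arcs, so all vertices are removed
      as well; finitely many points do not disconnect an open connected set in the plane.\<close>
    define U where "U = - drawn \<gamma> F - f ` \<Union>E"
    have U: "connected U"
      unfolding U_def using \<open>connected (- drawn \<gamma> F)\<close> F.open_compl_drawn[OF order_refl] finite_vertices
      by (intro connected_open_delete_finite) auto
    have face_U: "\<Psi> \<subseteq> U" "\<Psi> \<noteq> {}" if "\<Psi> \<in> faces" for \<Psi>
    proof -
      have "\<Psi> \<subseteq> - drawn \<gamma> E" using that unfolding faces_def by (rule in_components_subset)
      moreover have "f ` \<Union>E \<subseteq> drawn \<gamma> E" using ends_subset unfolding drawn_def by fast
      ultimately have "drawn \<gamma> F \<union> f ` \<Union>E \<subseteq> drawn \<gamma> E" by (simp add: drawn_mono[OF F])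
      then have "- drawn \<gamma> E \<subseteq> U" unfolding U_def Diff_eq Compl_Un[symmetric] by (rule Compl_anti_mono)
      then show "\<Psi> \<subseteq> U" using \<open>\<Psi> \<subseteq> - drawn \<gamma> E\<close> by (rule order_trans[rotated])
      show "\<Psi> \<noteq> {}" using that unfolding faces_def by (rule in_components_nonempty)
    qed
    have "U \<inter> frontier \<Phi> = {}"
    proof (rule ccontr)
      assume "U \<inter> frontier \<Phi> \<noteq> {}"
      then obtain z where z: "z \<in> U" "z \<in> frontier \<Phi>" by blast
      obtain e where e: "e \<in> E" "z \<in> path_image (\<gamma> e)"
        using frontier_face[OF \<Phi>(1)] z(2) by (auto simp: drawn_def)
      have "z \<notin> f ` e" using z(1) e(1) by (auto simp: U_def)
      moreover have "z \<in> closure \<Phi>" using z(2) by (simp add: frontier_def)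
      ultimately have "e \<in> F" using e by (auto simp: F_def touches_def)
      then show False using z(1) e(2) by (auto simp: U_def drawn_def)
    qed
    then have "U \<subseteq> \<Phi>"
      using connected_Int_frontier[OF U, of \<Phi>] face_U[OF \<Phi>(1)] by blast
    then show False using faces_disjoint[OF \<Phi>] face_U[OF \<Phi>(2)] by blast
  qed
  then have "4 \<le> card {e \<in> F. cycle_edge F e}"
    using assms(1) F F.card_edge F.finite_edges
    by (intro not_forest_4_cycle_edges) (auto simp: no_triangle_def)
  also have "\<dots> \<le> card {e \<in> E. cycle_edge E e \<and> touches e \<Phi>}"
    using finite_edges cycle_edge_mono[OF F] by (intro card_mono) (auto simp: F_def)
  finally show ?thesis .
qed

lemma faces_nonempty: "faces \<noteq> {}"
proof -
  have "drawn \<gamma> E \<noteq> UNIV"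
    using compact_drawn[OF order_refl] compact_imp_bounded not_bounded_UNIV by metis
  then show ?thesis by (auto simp: faces_def)
qed

end

section \<open>Euler's inequality and the edge bound\<close>

text \<open>Delete cycle edges, each costing at least one face, until a forest remains. Equality can
  fail since the graph may be disconnected.\<close>

lemma card_edges_le_faces:
  assumes "plane_arcs E f \<gamma>" "finite (plane_arcs.faces E \<gamma>)" "finite V" "V \<noteq> {}" "\<Union>E \<subseteq> V"
  shows "card E + 2 \<le> card V + card (plane_arcs.faces E \<gamma>)"
  using assms(1,2,5)
proof (induction "card E" arbitrary: E rule: less_induct)
  case less
  interpret plane_arcs E f \<gamma> by fact
  show ?case
  proof (cases "forest E")
    case True
    have "card E < card V"
      using assms(3,4) less.prems(3) True card_edge by (rule forest_card)
    moreover have "card faces \<noteq> 0" using faces_nonempty less.prems(2) by simp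
    ultimately show ?thesis by linarith
  next
    case False
    then obtain e where e: "e \<in> E" "cycle_edge E e" by (auto simp: forest_def)
    interpret D: plane_arcs "E - {e}" f \<gamma> by (rule plane_arcs_subset) auto
    note * = card_faces_delete_cycle_edge[OF e(2) less.prems(2), folded D.faces_def]
    have "card (E - {e}) + 2 \<le> card V + card D.faces"
      using less.hyps[of "E - {e}"] * D.plane_arcs_axioms less.prems(3) e(1) finite_edges
        card_Diff1_less[of E e] by auto
    moreover have "card E = Suc (card (E - {e}))" using e(1) finite_edges by (metis card_Suc_Diff1)
    ultimately show ?thesis using *(2) by linarith
  qed
qed

context plane_arcs
begin

text \<open>Counting pairs of a cycle edge and a face it touches gives \<open>4F \<le> 2e\<close>;
  Euler's inequality does the rest. With a single face, it suffices alone because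
  \<open>3 \<le> card V\<close>.\<close>

lemma card_edges_triangle_free:
  assumes "no_triangle E" "finite V" "\<Union>E \<subseteq> V" "3 \<le> card V"
  shows "card E + 4 \<le> 2 * card V"
proof (cases "\<exists>\<Phi>. faces = {\<Phi>}")
  case True
  then have "card faces = 1" "finite faces" by auto
  then show ?thesis
    using card_edges_le_faces[OF plane_arcs_axioms _ assms(2) _ assms(3)] assms(4) by fastforce
next
  case False
  let ?C = "{e \<in> E. cycle_edge E e}"
  have four: "4 \<le> card {e \<in> ?C. touches e \<Phi>}" if \<Phi>: "\<Phi> \<in> faces" for \<Phi>
  proof -
    obtain \<Phi>' where "\<Phi>' \<in> faces" "\<Phi> \<noteq> \<Phi>'" using False \<Phi> by blast
    from face_touches_4_cycle_edges[OF assms(1) \<Phi> this] show ?thesis by simp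
  qed
  \<comment> \<open>Finiteness of \<open>faces\<close> comes from here: each face touches a cycle
    edge, and each cycle edge touches finitely many faces.\<close>
  have "faces \<subseteq> (\<Union>e\<in>?C. {\<Phi> \<in> faces. touches e \<Phi>})"
  proof
    fix \<Phi> assume \<Phi>: "\<Phi> \<in> faces"
    then have "{e \<in> ?C. touches e \<Phi>} \<noteq> {}"
      using four[OF \<Phi>] by (metis card.empty not_numeral_le_zero)
    then show "\<Phi> \<in> (\<Union>e\<in>?C. {\<Phi> \<in> faces. touches e \<Phi>})" using \<Phi> by blast
  qed
  moreover have "finite (\<Union>e\<in>?C. {\<Phi> \<in> faces. touches e \<Phi>})"
    using finite_edges faces_touching_cycle_edge(1) by auto
  ultimately have fin: "finite faces" by (rule finite_subset)
  have "4 * card faces \<le> (\<Sum>\<Phi>\<in>faces. card {e \<in> ?C. touches e \<Phi>})"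
    using sum_mono[of faces "\<lambda>_. 4" "\<lambda>\<Phi>. card {e \<in> ?C. touches e \<Phi>}"] four by simp
  also have "\<dots> = (\<Sum>e\<in>?C. card {\<Phi> \<in> faces. touches e \<Phi>})"
    using fin finite_edges by (intro sum_multicount_gen) auto
  also have "\<dots> \<le> 2 * card ?C"
    using sum_mono[of ?C "\<lambda>e. card {\<Phi> \<in> faces. touches e \<Phi>}" "\<lambda>_. 2"] faces_touching_cycle_edge(2) by simp
  also have "\<dots> \<le> 2 * card E" using finite_edges by (simp add: card_mono)
  finally have "2 * card faces \<le> card E" by simp
  moreover have "card E + 2 \<le> card V + card faces"
    using card_edges_le_faces[OF plane_arcs_axioms fin assms(2) _ assms(3)] assms(4) by fastforce
  ultimately show ?thesis by linarith
qed

end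

section \<open>Optimising over the middle vertices\<close>

text \<open>The bound increases with \<open>s\<close> once \<open>2 \<le> d\<close>, so numbers of
  common neighbours may be replaced by upper bounds.\<close>

lemma middle_vertex_bound:
  fixes d s \<sigma> :: nat and t :: real
  assumes "t \<le> ((real d + real s) / 2)\<^sup>2 - real s" "2 \<le> d" "s \<le> \<sigma>" "\<sigma> \<le> 2"
  shows "t \<le> ((real d + real \<sigma>) / 2)\<^sup>2 - real \<sigma>"
proof -
  \<comment> \<open>Four times the difference of the two bounds.\<close>
  have "0 \<le> (real \<sigma> - real s) * (2 * real d + real \<sigma> + real s - 4)"
    using assms by (cases "\<sigma> = s") auto
  then have "((real d + real s) / 2)\<^sup>2 - real s \<le> ((real d + real \<sigma>) / 2)\<^sup>2 - real \<sigma>"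
    by (simp add: power2_eq_square field_simps)
  with assms(1) show ?thesis by linarith
qed

text \<open>A convex function lies below its chord on an interval; this sums such chords under a
  bound on the total of \<open>e\<close>.\<close>

lemma sum_affine_bound:
  fixes t e :: "'b \<Rightarrow> real"
  assumes "\<And>x. x \<in> X \<Longrightarrow> t x \<le> K * e x + L" "0 \<le> K" "(\<Sum>x\<in>X. e x) \<le> M"
  shows "(\<Sum>x\<in>X. t x) \<le> K * M + L * real (card X)"
proof -
  have "(\<Sum>x\<in>X. t x) \<le> (\<Sum>x\<in>X. K * e x + L)" using assms(1) by (rule sum_mono)
  also have "\<dots> = K * (\<Sum>x\<in>X. e x) + L * real (card X)"
    by (simp add: sum.distrib sum_distrib_left)
  also have "\<dots> \<le> K * M + L * real (card X)" using assms(2,3) by (simp add: mult_left_mono)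
  finally show ?thesis .
qed

text \<open>In the application \<open>t x\<close> paths have middle vertex \<open>x\<close>, which has \<open>d x\<close> neighbours in
  \<open>A \<union> B\<close> and \<open>\<sigma> x\<close> in \<open>A \<inter> B\<close>, where \<open>m = |A \<union> B|\<close> and \<open>s = |A \<inter> B|\<close>. For \<open>s = 2\<close> equality is
  attained with a single middle vertex, so the constants leave no slack.\<close>

lemma sum_middle_vertices_bound:
  fixes t :: "'b \<Rightarrow> real" and d \<sigma> :: "'b \<Rightarrow> nat" and m s n :: nat
  assumes "finite X" "X \<noteq> {}"
    and t: "\<And>x. x \<in> X \<Longrightarrow> t x \<le> ((real (d x) + real (\<sigma> x)) / 2)\<^sup>2 - real (\<sigma> x)"
    and d2: "\<And>x. x \<in> X \<Longrightarrow> 2 \<le> d x"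
    and \<sigma>: "\<And>x. x \<in> X \<Longrightarrow> \<sigma> x \<le> 2" "\<And>x. x \<in> X \<Longrightarrow> \<sigma> x \<le> s"
    and dm: "\<And>x. x \<in> X \<Longrightarrow> d x \<le> m" "\<And>x. x \<in> X \<Longrightarrow> d x + s \<le> m + \<sigma> x"
    and sum_d: "(\<Sum>x\<in>X. d x) + s \<le> 2 * card X + m"
    and n: "m + card X + 2 \<le> n"
  shows "(\<Sum>x\<in>X. t x) \<le> ((real n - 1) / 2)\<^sup>2 - 2"
proof -
  define c where "c = real (card X)"
  define k where "k = real m - real s"
  \<comment> \<open>The excess over two neighbours: the edge bound now reads
    \<open>sum e \<le> k\<close>.\<close>
  define e where "e x = real (d x) - 2" for x
  have "card X \<ge> 1" using assms(1,2) by (simp add: Suc_le_eq card_gt_0_iff)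
  then have c1: "c \<ge> 1" by (simp add: c_def)
  have e0: "0 \<le> e x" if "x \<in> X" for x using d2[OF that] by (simp add: e_def)
  have ek: "e x \<le> k" if "x \<in> X" for x using dm(2)[OF that] \<sigma>(1)[OF that] by (simp add: e_def k_def)
  have em: "e x \<le> k + s - 2" if "x \<in> X" for x using dm(1)[OF that] by (simp add: e_def k_def)
  obtain x0 where x0: "x0 \<in> X" using assms(2) by blast
  have k0: "0 \<le> k" using e0[OF x0] ek[OF x0] by linarith
  have "real ((\<Sum>x\<in>X. d x) + s) \<le> real (2 * card X + m)" using sum_d by (rule of_nat_mono)
  then have sum_e: "(\<Sum>x\<in>X. e x) \<le> k"
    by (simp add: e_def sum_subtractf k_def)
  \<comment> \<open>\<open>k + s\<close> is \<open>m\<close>, so the base on the left is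
    \<open>(m + card X + 1) / 2\<close>.\<close>
  have target: "((k + s + c + 1) / 2)\<^sup>2 \<le> ((real n - 1) / 2)\<^sup>2"
  proof (rule power_mono)
    have "real (m + card X + 2) \<le> real n" using n by (rule of_nat_mono)
    then show "(k + s + c + 1) / 2 \<le> (real n - 1) / 2" by (simp add: k_def c_def)
  qed (use k0 c1 in simp)
  \<comment> \<open>\<open>\<sigma> x\<close> is raised to 2, 1 or 0. For \<open>s\<close> below 2,
    \<open>e x \<le> k + s - 2\<close> is sharper than \<open>e x \<le> k\<close> and gives a
    shorter chord.\<close>
  consider "2 \<le> s" | "s = 1" | "s = 0" by linarith
  then have "(\<Sum>x\<in>X. t x) \<le> ((k + s + c + 1) / 2)\<^sup>2 - 2"
  proof cases
    case 1
    have "t x \<le> (k / 4 + 2) * e x + 2" if x: "x \<in> X" for x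
    proof -
      have "t x \<le> ((real (d x) + real 2) / 2)\<^sup>2 - real 2"
        by (rule middle_vertex_bound[OF t[OF x] d2[OF x] \<sigma>(1)[OF x] order_refl])
      also have "\<dots> = e x * e x / 4 + 2 * e x + 2"
        by (simp add: e_def power2_eq_square field_simps)
      also have "e x * e x \<le> k * e x" using ek[OF x] e0[OF x] by (rule mult_right_mono)
      finally show ?thesis by (simp add: field_simps)
    qed
    then have "(\<Sum>x\<in>X. t x) \<le> (k / 4 + 2) * k + 2 * c"
      unfolding c_def using k0 sum_e by (intro sum_affine_bound) auto
    also have "\<dots> \<le> ((k + c + 3) / 2)\<^sup>2 - 2"
    proof -
      \<comment> \<open>The difference vanishes at \<open>c = 1\<close>, the extremal case.\<close>
      have "((k + c + 3) / 2)\<^sup>2 - 2 - ((k / 4 + 2) * k + 2 * c) = k * (c - 1) / 2 + (c - 1)\<^sup>2 / 4"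
        by (simp add: power2_eq_square field_simps)
      moreover have "0 \<le> k * (c - 1)" using k0 c1 by simp
      ultimately show ?thesis using zero_le_power2[of "c - 1"] by linarith
    qed
    also have "\<dots> \<le> ((k + s + c + 1) / 2)\<^sup>2 - 2"
      using 1 k0 c1 by (intro diff_right_mono power_mono) auto
    finally show ?thesis .
  next
    case 2
    have tx: "t x \<le> e x * e x / 4 + 3 / 2 * e x + 5 / 4" if x: "x \<in> X" for x
    proof -
      have "t x \<le> ((real (d x) + real 1) / 2)\<^sup>2 - real 1"
        using \<sigma>(2)[OF x] 2 by (intro middle_vertex_bound[OF t[OF x] d2[OF x]]) auto
      also have "\<dots> = e x * e x / 4 + 3 / 2 * e x + 5 / 4"
        by (simp add: e_def power2_eq_square field_simps)
      finally show ?thesis .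
    qed
    have tx': "t x \<le> ((k - 1) / 4 + 3 / 2) * e x + 5 / 4" if x: "x \<in> X" for x
    proof -
      have "e x * e x \<le> (k - 1) * e x" using em[OF x] e0[OF x] 2 by (intro mult_right_mono) auto
      with tx[OF x] show ?thesis by (simp add: field_simps)
    qed
    have k1: "1 \<le> k" using em[OF x0] e0[OF x0] 2 by simp
    show ?thesis
    \<comment> \<open>For one middle vertex and small \<open>k\<close> the bound
      \<open>sum e \<le> k\<close> is too weak; \<open>e x0 \<le> k - 1\<close> replaces it.\<close>
    proof (cases "card X = 1")
      case True
      then have X: "X = {x0}" using x0 by (metis card_1_singletonE singletonD)
      have "t x0 \<le> ((k - 1) / 4 + 3 / 2) * e x0 + 5 / 4" using tx'[OF x0] .
      also have "\<dots> \<le> ((k - 1) / 4 + 3 / 2) * (k - 1) + 5 / 4"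
        using em[OF x0] 2 k1 by (intro add_right_mono mult_left_mono) auto
      also have "\<dots> \<le> ((k + s + c + 1) / 2)\<^sup>2 - 2"
        using True 2 k1 by (simp add: c_def power2_eq_square field_simps)
      finally show ?thesis by (simp add: X)
    next
      case False
      then have c2: "2 \<le> c" using c1 by (simp add: c_def)
      have "(\<Sum>x\<in>X. t x) \<le> ((k - 1) / 4 + 3 / 2) * k + 5 / 4 * c"
        unfolding c_def using k1 sum_e tx' by (intro sum_affine_bound) auto
      also have "\<dots> \<le> ((k + s + c + 1) / 2)\<^sup>2 - 2"
      proof -
        have "((k + s + c + 1) / 2)\<^sup>2 - 2 - (((k - 1) / 4 + 3 / 2) * k + 5 / 4 * c)
            = (k - 1) * (c / 2 - 1 / 4) + (c - 2) * (c + 3) / 4 + 1 / 4"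
          using 2 by (simp add: power2_eq_square field_simps)
        moreover have "0 \<le> (k - 1) * (c / 2 - 1 / 4)" "0 \<le> (c - 2) * (c + 3)" using k1 c2 by auto
        ultimately show ?thesis by linarith
      qed
      finally show ?thesis .
    qed
  next
    case 3
    have tx: "t x \<le> ((k - 2) / 4 + 1) * e x + 1" if x: "x \<in> X" for x
    proof -
      have "t x \<le> ((real (d x) + real 0) / 2)\<^sup>2 - real 0"
        using \<sigma>(2)[OF x] 3 by (intro middle_vertex_bound[OF t[OF x] d2[OF x]]) auto
      also have "\<dots> = e x * e x / 4 + e x + 1"
        by (simp add: e_def power2_eq_square field_simps)
      also have "e x * e x \<le> (k - 2) * e x" using em[OF x] e0[OF x] 3 by (intro mult_right_mono) auto
      finally show ?thesis by (simp add: field_simps)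
    qed
    have k2: "2 \<le> k" using em[OF x0] e0[OF x0] 3 by simp
    show ?thesis
    \<comment> \<open>As before, a single middle vertex uses its own bound, here
      \<open>e x0 \<le> k - 2\<close>.\<close>
    proof (cases "card X = 1")
      case True
      then have X: "X = {x0}" using x0 by (metis card_1_singletonE singletonD)
      have "t x0 \<le> ((k - 2) / 4 + 1) * e x0 + 1" using tx[OF x0] .
      also have "\<dots> \<le> ((k - 2) / 4 + 1) * (k - 2) + 1"
        using em[OF x0] 3 k2 by (intro add_right_mono mult_left_mono) auto
      also have "\<dots> \<le> ((k + s + c + 1) / 2)\<^sup>2 - 2"
        using True 3 k2 by (simp add: c_def power2_eq_square field_simps)
      finally show ?thesis by (simp add: X)
    next
      case False
      then have c2: "2 \<le> c" using c1 by (simp add: c_def)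
      have "(\<Sum>x\<in>X. t x) \<le> ((k - 2) / 4 + 1) * k + 1 * c"
        unfolding c_def using k2 sum_e tx by (intro sum_affine_bound) auto
      also have "\<dots> \<le> ((k + s + c + 1) / 2)\<^sup>2 - 2"
      proof -
        have "((k + s + c + 1) / 2)\<^sup>2 - 2 - (((k - 2) / 4 + 1) * k + 1 * c)
            = (k - 2) * c / 2 + (c - 2) * (c + 4) / 4 + 1 / 4"
          using 3 by (simp add: power2_eq_square field_simps)
        moreover have "0 \<le> (k - 2) * c" "0 \<le> (c - 2) * (c + 4)" using k2 c2 by auto
        ultimately show ?thesis by linarith
      qed
      finally show ?thesis .
    qed
  qed
  with target show ?thesis by linarith
qed

section \<open>Counting the paths\<close>

text \<open>\<open>H\<close> lists each edge once, directed from \<open>P\<close> to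
  \<open>Q\<close>, so the edge bound applies directly to a set of pairs.\<close>

lemma planar_bipartite_card:
  assumes "pair_graph G" "planar G" "triangle_free G"
    and PQ: "finite P" "finite Q" "P \<inter> Q = {}" "3 \<le> card P + card Q"
    and H: "H \<subseteq> parcs G" "H \<subseteq> P \<times> Q"
  shows "card H + 4 \<le> 2 * (card P + card Q)"
proof -
  interpret pair_graph G by fact
  obtain f c where "plane_drawing G f c" using assms(2) by (auto simp: planar_def)
  note drawing = this[unfolded plane_drawing_def]
  have inj: "inj_on f (pverts G)" using drawing by (rule conjunct1)
  have edge: "Path_Connected.arc (c {x, y}) \<and>
      {pathstart (c {x, y}), pathfinish (c {x, y})} = {f x, f y}" if "(x, y) \<in> parcs G" for x y
    using bspec[OF conjunct1[OF conjunct2[OF drawing]] that] by simp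
  have meet: "path_image (c {x, y}) \<inter> path_image (c {x', y'}) \<subseteq> f ` ({x, y} \<inter> {x', y'})"
    if xy: "(x, y) \<in> parcs G" "(x', y') \<in> parcs G" "{x, y} \<noteq> {x', y'}" for x y x' y'
    using bspec[OF bspec[OF conjunct2[OF conjunct2[OF drawing]] xy(1), simplified] xy(2)] xy(3) by simp
  define E where "E = (\<lambda>(x, y). {x, y}) ` H"
  have EE: "\<exists>x y. e = {x, y} \<and> (x, y) \<in> parcs G" if "e \<in> E" for e
    using that H(1) by (auto simp: E_def)
  have sym_arcs: "(y, x) \<in> parcs G" if "(x, y) \<in> parcs G" for x y
    using that pair_sym_arcs by (auto simp: symmetric_def dest: symD)
  have arcs_E: "(x, y) \<in> parcs G" if "{x, y} \<in> E" for x y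
    using EE[OF that] sym_arcs by (auto simp: doubleton_eq_iff)
  interpret plane_arcs E f c
  proof
    show "finite E" using H PQ unfolding E_def by (meson finite_SigmaI finite_imageI finite_subset)
    show "card e = 2" if "e \<in> E" for e
      using EE[OF that] pair_no_loops by fastforce
    have "\<Union>E \<subseteq> pverts G"
      using EE in_arcsD1 in_arcsD2 by fast
    then show "inj_on f (\<Union>E)" using inj by (rule inj_on_subset[rotated])
    show "Path_Connected.arc (c e)" "{pathstart (c e), pathfinish (c e)} = f ` e" if "e \<in> E" for e
      using EE[OF that] edge by (metis, metis image_empty image_insert)
    show "path_image (c e) \<inter> path_image (c e') \<subseteq> f ` (e \<inter> e')"
      if "e \<in> E" "e' \<in> E" "e \<noteq> e'" for e e'
      using EE[OF that(1)] EE[OF that(2)] meet that(3) by blast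
  qed
  have "no_triangle E"
    using assms(3) arcs_E unfolding no_triangle_def triangle_free_def by blast
  moreover have "\<Union>E \<subseteq> P \<union> Q" using H(2) by (auto simp: E_def)
  moreover have "card (P \<union> Q) = card P + card Q" using PQ by (simp add: card_Un_disjoint)
  ultimately have "card E + 4 \<le> 2 * (card P + card Q)"
    using card_edges_triangle_free[of "P \<union> Q"] PQ by simp
  \<comment> \<open>As \<open>P\<close> and \<open>Q\<close> are disjoint, an unordered edge
    determines its direction.\<close>
  moreover have "inj_on (\<lambda>(x, y). {x, y}) H"
    using H(2) PQ(3) by (force simp: inj_on_def doubleton_eq_iff)
  then have "card E = card H" unfolding E_def by (rule card_image)
  ultimately show ?thesis by simp
qed

lemma card_distinct_pairs:
  assumes "finite A" "finite B"
  shows "real (card {(a, b). a \<in> A \<and> b \<in> B \<and> a \<noteq> b}) = real (card A) * real (card B) - real (card (A \<inter> B))"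
proof -
  have "{(a, b). a \<in> A \<and> b \<in> B \<and> a \<noteq> b} = A \<times> B - (\<lambda>a. (a, a)) ` (A \<inter> B)" by auto
  moreover have "(\<lambda>a. (a, a)) ` (A \<inter> B) \<subseteq> A \<times> B" by auto
  moreover have "card ((\<lambda>a. (a, a)) ` (A \<inter> B)) = card (A \<inter> B)"
    by (rule card_image) (simp add: inj_on_def)
  ultimately show ?thesis
    using assms card_mono[of "A \<times> B" "(\<lambda>a. (a, a)) ` (A \<inter> B)"]
    by (simp add: card_Diff_subset of_nat_diff card_cartesian_product)
qed

theorem theorem10:
  fixes G :: "'a pair_pre_digraph" and n :: nat and u v :: 'a
  assumes "pair_graph G"
    and "planar G"
    and "triangle_free G"
    and "card (pverts G) = n"
    and "n \<ge> 5"
    and "u \<in> pverts G"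
    and "v \<in> pverts G"
    and "u \<noteq> v"
  shows "real (card (paths_between G 4 u v)) \<le> ((real n - 1) / 2)\<^sup>2 - 2"
proof -
  interpret pair_graph G by fact
  note bip = planar_bipartite_card[OF assms(1-3)]
  have sym_arcs: "(y, x) \<in> parcs G" if "(x, y) \<in> parcs G" for x y
    using that pair_sym_arcs by (auto simp: symmetric_def dest: symD)
  have noloop: "(x, x) \<notin> parcs G" for x using pair_no_loops by fastforce
  have tf: False if "(x, y) \<in> parcs G" "(y, z) \<in> parcs G" "(z, x) \<in> parcs G" for x y z
    using that assms(3) unfolding triangle_free_def by blast
  define N where "N x = {y. (x, y) \<in> parcs G}" for x
  \<comment> \<open>The end \<open>v\<close> is removed since it cannot be the second vertex of the
    path; likewise \<open>u\<close> for \<open>B\<close>.\<close>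
  define A where "A = N u - {v}"
  define B where "B = N v - {u}"
  define D where "D x = {(a, b). a \<in> A \<inter> N x \<and> b \<in> B \<inter> N x \<and> a \<noteq> b}" for x
  \<comment> \<open>Only vertices that are the middle of some path are kept, which ensures
    \<open>2 \<le> ?d x\<close>.\<close>
  define X where "X = {x \<in> pverts G. x \<noteq> u \<and> x \<noteq> v \<and> D x \<noteq> {}}"
  have N_sub: "N x \<subseteq> pverts G" for x using in_arcsD2 by (auto simp: N_def)
  have finN: "finite (N x)" for x using N_sub pair_finite_verts by (rule finite_subset)
  have fin: "finite A" "finite B" "finite X" using finN pair_finite_verts by (auto simp: A_def B_def X_def)
  have DE: "\<exists>a b. a \<in> A \<and> a \<in> N x \<and> b \<in> B \<and> b \<in> N x \<and> a \<noteq> b" if "x \<in> X" for x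
    using that by (auto simp: X_def D_def)
  have X_disj: "X \<inter> (A \<union> B) = {}"
  proof -
    \<comment> \<open>Otherwise \<open>u, x, a\<close> or \<open>v, x, b\<close> would be a
      triangle.\<close>
    have "x \<notin> A" "x \<notin> B" if x: "x \<in> X" for x
    proof -
      obtain a b where "(u, a) \<in> parcs G" "(x, a) \<in> parcs G" "(v, b) \<in> parcs G" "(x, b) \<in> parcs G"
        using DE[OF x] by (auto simp: A_def B_def N_def)
      then show "x \<notin> A" "x \<notin> B"
        using tf[of u x a] tf[of v x b] sym_arcs by (auto simp: A_def B_def N_def)
    qed
    then show ?thesis by blast
  qed
  have uv_disj: "u \<notin> A \<union> B" "v \<notin> A \<union> B" using noloop by (auto simp: A_def B_def N_def)
  define m s where "m = card (A \<union> B)" and "s = card (A \<inter> B)"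
  have ms: "card A + card B = m + s" unfolding m_def s_def using fin(1,2) by (rule card_Un_Int)
  let ?d = "\<lambda>x. card ((A \<union> B) \<inter> N x)" and ?\<sigma> = "\<lambda>x. card (A \<inter> B \<inter> N x)"
  have card_uvX: "card ({u, v} \<union> X) = 2 + card X"
    using fin assms(8) by (subst card_Un_disjoint) (auto simp: X_def)
  have paths: "paths_between G 4 u v \<subseteq> (\<lambda>(x, a, b). [(u, a), (a, x), (x, b), (b, v)]) ` (SIGMA x:X. D x)"
  proof
    fix p assume "p \<in> paths_between G 4 u v"
    then have p: "set p \<subseteq> parcs G" "pcas u p v" "distinct (pawalk_verts u p)" "length p = 4"
      by (auto simp: paths_between_def apath_def awalk_def)
    then obtain e1 e2 e3 e4 where "p = [e1, e2, e3, e4]"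
      by (auto simp: numeral_eq_Suc length_Suc_conv)
    then obtain a x b where pp: "p = [(u, a), (a, x), (x, b), (b, v)]"
      using p(2) by (cases e1; cases e2; cases e3; cases e4) auto
    have "(a, b) \<in> D x" "x \<in> X"
      using p(1,3) sym_arcs in_arcsD1 by (auto simp: pp D_def X_def A_def B_def N_def)
    then show "p \<in> (\<lambda>(x, a, b). [(u, a), (a, x), (x, b), (b, v)]) ` (SIGMA x:X. D x)"
      by (intro image_eqI[where x = "(x, a, b)"]) (auto simp: pp)
  qed
  have finD: "finite (D x)" for x
    by (rule finite_subset[of _ "A \<times> B"]) (use fin in \<open>auto simp: D_def\<close>)
  have "card (paths_between G 4 u v) \<le> card (SIGMA x:X. D x)"
    using paths fin finD by (intro surj_card_le) auto
  then have "real (card (paths_between G 4 u v)) \<le> (\<Sum>x\<in>X. real (card (D x)))"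
    using fin finD by (simp add: card_SigmaI flip: of_nat_sum)
  also have "\<dots> \<le> ((real n - 1) / 2)\<^sup>2 - 2"
  proof (cases "X = {}")
    case True
    \<comment> \<open>With no path at all, \<open>5 \<le> n\<close> makes the right-hand side at
      least 2.\<close>
    have "2\<^sup>2 \<le> ((real n - 1) / 2)\<^sup>2" using assms(5) by (intro power_mono) auto
    then show ?thesis using True by simp
  next
    case False
    show ?thesis
    proof (rule sum_middle_vertices_bound[where d = ?d and \<sigma> = ?\<sigma> and m = m and s = s])
      fix x assume x: "x \<in> X"
      let ?a = "card (A \<inter> N x)" and ?b = "card (B \<inter> N x)"
      have "?a + ?b = ?d x + ?\<sigma> x"
        using card_Un_Int[of "A \<inter> N x" "B \<inter> N x"] fin
        by (simp add: Int_Un_distrib2 Int_assoc Int_left_commute)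
      then have ab: "real ?a + real ?b = real (?d x) + real (?\<sigma> x)" by linarith
      have "real (card (D x)) = real ?a * real ?b - real (?\<sigma> x)"
        using card_distinct_pairs[of "A \<inter> N x" "B \<inter> N x"] fin by (simp add: D_def Int_ac)
      \<comment> \<open>The inequality of arithmetic and geometric means.\<close>
      also have "real ?a * real ?b \<le> ((real ?a + real ?b) / 2)\<^sup>2"
        using zero_le_power2[of "real ?a - real ?b"] by (simp add: power2_eq_square field_simps)
      finally show "real (card (D x)) \<le> ((real (?d x) + real (?\<sigma> x)) / 2)\<^sup>2 - real (?\<sigma> x)"
        by (simp add: ab)
      obtain a b where ab: "a \<in> A" "a \<in> N x" "b \<in> B" "b \<in> N x" "a \<noteq> b" using DE[OF x] by blast
      have "card {a, b} \<le> ?d x" using ab fin by (intro card_mono) auto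
      then show "2 \<le> ?d x" using ab(5) by simp
      show "?\<sigma> x \<le> s" unfolding s_def using fin by (intro card_mono) auto
      show "?d x \<le> m" unfolding m_def using fin by (intro card_mono) auto
      have "?d x + s = card ((A \<union> B) \<inter> N x \<union> (A \<inter> B)) + card ((A \<union> B) \<inter> N x \<inter> (A \<inter> B))"
        unfolding s_def using fin by (intro card_Un_Int) auto
      also have "card ((A \<union> B) \<inter> N x \<union> (A \<inter> B)) \<le> m"
        unfolding m_def using fin by (intro card_mono) auto
      also have "(A \<union> B) \<inter> N x \<inter> (A \<inter> B) = A \<inter> B \<inter> N x" by auto
      finally show "?d x + s \<le> m + ?\<sigma> x" by simp
      have xuv: "x \<noteq> u" "x \<noteq> v" using x by (auto simp: X_def)
      \<comment> \<open>A complete bipartite graph between 3 and \<sigma> vertices: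
        \<open>3\<sigma> + 4 \<le> 2(3 + \<sigma>)\<close> forces
        \<open>\<sigma> \<le> 2\<close>.\<close>
      have "card ({u, v, x} \<times> (A \<inter> B \<inter> N x)) + 4 \<le> 2 * (card {u, v, x} + ?\<sigma> x)"
        using fin X_disj uv_disj x assms(8) xuv by (intro bip) (auto simp: A_def B_def N_def)
      then show "?\<sigma> x \<le> 2" using assms(8) xuv by (simp add: card_cartesian_product)
    next
      have "{u, v} \<union> X \<union> (A \<union> B) \<subseteq> pverts G"
        using assms(6,7) N_sub by (auto simp: X_def A_def B_def)
      then have "card ({u, v} \<union> X \<union> (A \<union> B)) \<le> n"
        using assms(4) pair_finite_verts card_mono by blast
      moreover have "card ({u, v} \<union> X \<union> (A \<union> B)) = 2 + card X + m"
        unfolding m_def using card_uvX fin X_disj uv_disj by (subst card_Un_disjoint) auto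
      ultimately show "m + card X + 2 \<le> n" by simp
      \<comment> \<open>The edges between \<open>{u, v} \<union> X\<close> and
        \<open>A \<union> B\<close>; those at \<open>u\<close> and \<open>v\<close> contribute
        \<open>card A + card B = m + s\<close>.\<close>
      let ?H = "{u} \<times> A \<union> ({v} \<times> B \<union> (SIGMA x:X. (A \<union> B) \<inter> N x))"
      have "card ?H = card A + (card B + (\<Sum>x\<in>X. ?d x))"
        using fin assms(8) by (subst card_Un_disjoint, (auto simp: X_def)[3], subst card_Un_disjoint)
          (auto simp: X_def card_cartesian_product card_SigmaI)
      moreover have "card ?H + 4 \<le> 2 * (card ({u, v} \<union> X) + card (A \<union> B))"
      proof (rule bip)
        show "3 \<le> card ({u, v} \<union> X) + card (A \<union> B)"
          using card_uvX False fin by (simp add: Suc_le_eq card_gt_0_iff)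
        show "finite ({u, v} \<union> X)" "finite (A \<union> B)" using fin by simp_all
        show "({u, v} \<union> X) \<inter> (A \<union> B) = {}" using X_disj uv_disj by blast
        show "?H \<subseteq> parcs G" by (auto simp: A_def B_def N_def)
        show "?H \<subseteq> ({u, v} \<union> X) \<times> (A \<union> B)" by blast
      qed
      ultimately show "(\<Sum>x\<in>X. ?d x) + s \<le> 2 * card X + m"
        using ms card_uvX by (simp add: m_def)
    qed (use fin False in auto)
  qed
  finally show ?thesis .
qed

end
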